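(* Let $G$ be a simple mixed graph on $n$ vertices with $e(G)$ edges and $a(G)$ arcs, and let $\boldsymbol{\lambda}_1(G)$ be the largest eigenvalue of $\mathcal{I}(G)$. Then $$\boldsymbol{\lambda}_1(G)\le\left(\frac{(2n-1)(2e(G)+a(G))}{n}\right)^{\frac12}.$$
   Context: A mixed graph $G$ has a finite nonempty vertex set $V_G=\{v_1,\dots,v_n\}$, a finite set $E_G$ of (undirected) edges, each joining an unordered pair of vertices $\{u,v\}$ (a loop if $u=v$), and a finite set $\vec E_G$ of arcs, each going from $u$ to $v$ for an ordered pair $(u,v)$ of vertices (a directed loop if $u=v$); multiple edges, loops, arcs and directed loops are allowed. $G$ is simple if it has no loops, no directed loops, at most one edge joining any two vertices, and at most one arc from $u$ to $v$ for each ordered pair $(u,v)$ (an edge and arcs in both directions may coexist on the same pair of vertices). The integrated adjacency matrix $\mathcal{I}(G)$ is the real symmetric $2n\times 2n$ matrix $\begin{bmatrix}A&D\\ D^T&A\end{bmatrix}$, where $A_{ij}$ ($i\neq j$) is the number of edges joining $v_i$ and $v_j$, $A_{ii}$ is twice the number of loops at $v_i$, and $D_{ij}$ is the number of arcs from $v_i$ to $v_j$. *)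

theory Defs
  imports
    Complex_Main
    "HOL-Library.Uprod"
    "Jordan_Normal_Form.Matrix"
    "Jordan_Normal_Form.Spectral_Radius"
begin

text \<open>
  Edges and arcs are abstract identifiers with end points attached, so that multiple edges and
  multiple arcs are possible. An edge \<open>e\<close> with \<open>ends G e = Upair u u\<close> is a loop at \<open>u\<close>; an arc
  \<open>a\<close> goes from \<open>tail G a\<close> to \<open>head G a\<close>.
\<close>

record ('v, 'e, 'a) mixed_graph =
  verts :: "'v set"
  edges :: "'e set"
  arcs :: "'a set"
  ends :: "'e \<Rightarrow> 'v uprod"
  tail :: "'a \<Rightarrow> 'v"
  head :: "'a \<Rightarrow> 'v"

definition edges_between :: "('v, 'e, 'a) mixed_graph \<Rightarrow> 'v \<Rightarrow> 'v \<Rightarrow> 'e set" where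
  "edges_between G u w = {e \<in> edges G. ends G e = Upair u w}"

definition arcs_from_to :: "('v, 'e, 'a) mixed_graph \<Rightarrow> 'v \<Rightarrow> 'v \<Rightarrow> 'a set" where
  "arcs_from_to G u w = {a \<in> arcs G. tail G a = u \<and> head G a = w}"

locale mixed_graph =
  fixes G :: "('v, 'e, 'a) mixed_graph"
  assumes finite_verts: "finite (verts G)"
    and verts_nonempty: "verts G \<noteq> {}"
    and finite_edges: "finite (edges G)"
    and finite_arcs: "finite (arcs G)"
    and ends_in_verts: "e \<in> edges G \<Longrightarrow> set_uprod (ends G e) \<subseteq> verts G"
    and tail_in_verts: "a \<in> arcs G \<Longrightarrow> tail G a \<in> verts G"
    and head_in_verts: "a \<in> arcs G \<Longrightarrow> head G a \<in> verts G"

locale simple_mixed_graph = mixed_graph +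
  assumes no_loops: "u \<in> verts G \<Longrightarrow> edges_between G u u = {}"
    and no_directed_loops: "u \<in> verts G \<Longrightarrow> arcs_from_to G u u = {}"
    and no_multi_edges:
      "u \<in> verts G \<Longrightarrow> w \<in> verts G \<Longrightarrow> card (edges_between G u w) \<le> 1"
    and no_multi_arcs:
      "u \<in> verts G \<Longrightarrow> w \<in> verts G \<Longrightarrow> card (arcs_from_to G u w) \<le> 1"

text \<open>
  The matrices depend on an enumeration \<open>v 0, \<dots>, v (n - 1)\<close> of the \<open>n\<close> vertices, that is, on a
  map \<open>v\<close> with \<open>bij_betw v {..<n} (verts G)\<close>.
\<close>

definition edge_adj_mat :: "('v, 'e, 'a) mixed_graph \<Rightarrow> (nat \<Rightarrow> 'v) \<Rightarrow> real mat" where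
  "edge_adj_mat G v = mat (card (verts G)) (card (verts G))
     (\<lambda>(i, j). if i = j then 2 * real (card (edges_between G (v i) (v i)))
               else real (card (edges_between G (v i) (v j))))"

definition arc_adj_mat :: "('v, 'e, 'a) mixed_graph \<Rightarrow> (nat \<Rightarrow> 'v) \<Rightarrow> real mat" where
  "arc_adj_mat G v = mat (card (verts G)) (card (verts G))
     (\<lambda>(i, j). real (card (arcs_from_to G (v i) (v j))))"

definition integrated_adj_mat :: "('v, 'e, 'a) mixed_graph \<Rightarrow> (nat \<Rightarrow> 'v) \<Rightarrow> real mat" where
  "integrated_adj_mat G v =
     four_block_mat (edge_adj_mat G v) (arc_adj_mat G v)
       (transpose_mat (arc_adj_mat G v)) (edge_adj_mat G v)"

text \<open>
  This is only meaningful when \<open>M\<close> has a real eigenvalue, as every symmetric real matrix of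
  positive dimension does; integrated adjacency matrices are of this kind.
\<close>

definition largest_eigenvalue :: "real mat \<Rightarrow> real" where
  "largest_eigenvalue M = Max (spectrum M)"

end

theory Submission
  imports Defs "HOL-Analysis.Convex"
begin

text \<open>
  Write \<open>M\<close> for the integrated adjacency matrix and \<open>N = 2 n\<close> for its dimension. Since the graph
  is simple, \<open>M\<close> has zero diagonal and entries in \<open>{0, 1}\<close>. The squared Frobenius norm of \<open>M\<close> is
  therefore the sum of its entries. Each edge accounts for two entries in both copies of the edge
  block and each arc for one entry in both arc blocks, so this sum is \<open>4 e(G) + 2 a(G)\<close>.

  If \<open>x\<close> is a unit eigenvector for \<open>k\<close>, then, because \<open>M\<close> has trace zero, \<open>k\<close> is the Frobenius
  inner product of \<open>M\<close> with \<open>x x\<^sup>T - I / N\<close>, a matrix whose squared Frobenius norm is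
  \<open>1 - 1 / N\<close>. The Cauchy--Schwarz inequality yields \<open>k\<^sup>2 \<le> (1 - 1 / N) (4 e(G) + 2 a(G))\<close>, which is
  the claimed bound (\<open>eigenvalue_sq_le_of_trace_zero\<close>), for every real eigenvalue \<open>k\<close>. What
  remains is that the maximum of the spectrum is an eigenvalue, that is, that the spectrum is
  nonempty: a symmetric real matrix has a real eigenvalue because all eigenvalues of its
  complexification are real (\<open>spectrum_symmetric_nonempty\<close>).
\<close>

section \<open>Eigenvalues of trace-free matrices\<close>

lemma eigenvalue_sumE:
  fixes A :: "'a :: comm_ring_1 mat"
  assumes A: "A \<in> carrier_mat N N" and k: "eigenvalue A k"
  obtains x where "\<And>i. i < N \<Longrightarrow> (\<Sum>j<N. A $$ (i,j) * x j) = k * x i" "\<exists>i<N. x i \<noteq> 0"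
proof -
  obtain z where z: "z \<in> carrier_vec N" "z \<noteq> 0\<^sub>v N" "A *\<^sub>v z = k \<cdot>\<^sub>v z"
    using k A unfolding eigenvalue_def eigenvector_def by auto
  have "(\<Sum>j<N. A $$ (i,j) * z $ j) = k * z $ i" if "i < N" for i
  proof -
    have "(A *\<^sub>v z) $ i = (\<Sum>j<N. A $$ (i,j) * z $ j)"
      using A z(1) that by (auto simp: scalar_prod_def atLeast0LessThan intro!: sum.cong)
    then show ?thesis using z that by simp
  qed
  moreover have "\<exists>i<N. z $ i \<noteq> 0"
    using z(1,2) by (metis carrier_vecD eq_vecI index_zero_vec)
  ultimately show ?thesis using that by blast
qed

text \<open>
  The matrix \<open>B\<close> in the proof is \<open>x x\<^sup>T - I / N\<close> of the unit case, multiplied by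
  \<open>N \<bar>x\<bar>\<^sup>2\<close> so that the eigenvector need not be normalised.
\<close>

lemma eigenvalue_sq_le_of_trace_zero:
  fixes A :: "real mat"
  assumes A: "A \<in> carrier_mat N N" and k: "eigenvalue A k"
    and tr: "(\<Sum>i<N. A $$ (i,i)) = 0"
  shows "real N * k\<^sup>2 \<le> (real N - 1) * (\<Sum>i<N. \<Sum>j<N. (A $$ (i,j))\<^sup>2)"
proof -
  obtain x where x: "\<And>i. i < N \<Longrightarrow> (\<Sum>j<N. A $$ (i,j) * x j) = k * x i"
    and nz: "\<exists>i<N. x i \<noteq> 0"
    using eigenvalue_sumE[OF A k] by blast
  define S where "S = (\<Sum>i<N. (x i)\<^sup>2)"
  define F where "F = (\<Sum>i<N. \<Sum>j<N. (A $$ (i,j))\<^sup>2)"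
  define B where "B i j = real N * (x i * x j) - (if i = j then S else 0)" for i j
  have N: "N > 0" using nz by auto
  have S: "S > 0"
    using nz unfolding S_def by (auto intro!: sum_pos2)
  have AB: "(\<Sum>i<N. \<Sum>j<N. A $$ (i,j) * B i j) = real N * k * S"
  proof -
    have "(\<Sum>j<N. A $$ (i,j) * B i j) = real N * k * (x i)\<^sup>2 - S * A $$ (i,i)"
      if "i < N" for i
    proof -
      have "(\<Sum>j<N. A $$ (i,j) * B i j)
        = (\<Sum>j<N. real N * x i * (A $$ (i,j) * x j) - (if i = j then S * A $$ (i,i) else 0))"
        by (intro sum.cong) (auto simp: B_def algebra_simps)
      also have "\<dots> = real N * x i * (\<Sum>j<N. A $$ (i,j) * x j) - S * A $$ (i,i)"
        using that by (simp add: sum_subtractf sum_distrib_left)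
      finally show ?thesis using x[OF that] by (simp add: power2_eq_square)
    qed
    then have "(\<Sum>i<N. \<Sum>j<N. A $$ (i,j) * B i j)
        = (\<Sum>i<N. real N * k * (x i)\<^sup>2 - S * A $$ (i,i))" by simp
    also have "\<dots> = real N * k * S - S * (\<Sum>i<N. A $$ (i,i))"
      by (simp add: sum_subtractf S_def flip: sum_distrib_left)
    finally show ?thesis using tr by simp
  qed
  have BB: "(\<Sum>i<N. \<Sum>j<N. (B i j)\<^sup>2) = real N * (real N - 1) * S\<^sup>2"
  proof -
    have "(\<Sum>j<N. (B i j)\<^sup>2) = (real N)\<^sup>2 * S * (x i)\<^sup>2 - 2 * real N * S * (x i)\<^sup>2 + S\<^sup>2"
      if "i < N" for i
    proof -
      have "(\<Sum>j<N. (B i j)\<^sup>2) = (\<Sum>j<N. (real N)\<^sup>2 * (x i)\<^sup>2 * (x j)\<^sup>2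
          + (if i = j then S\<^sup>2 - 2 * real N * S * (x i)\<^sup>2 else 0))"
        by (intro sum.cong) (auto simp: B_def power2_eq_square algebra_simps)
      also have "\<dots> = (real N)\<^sup>2 * (x i)\<^sup>2 * S + (S\<^sup>2 - 2 * real N * S * (x i)\<^sup>2)"
        using that by (simp add: sum.distrib S_def flip: sum_distrib_left)
      finally show ?thesis by (simp add: algebra_simps)
    qed
    then have "(\<Sum>i<N. \<Sum>j<N. (B i j)\<^sup>2)
        = (\<Sum>i<N. (real N)\<^sup>2 * S * (x i)\<^sup>2 - 2 * real N * S * (x i)\<^sup>2 + S\<^sup>2)" by simp
    also have "\<dots> = (real N)\<^sup>2 * S * S - 2 * real N * S * S + real N * S\<^sup>2"
      by (simp add: sum.distrib sum_subtractf S_def flip: sum_distrib_left)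
    finally show ?thesis by (simp add: power2_eq_square algebra_simps)
  qed
  have "(\<Sum>p\<in>{..<N} \<times> {..<N}. A $$ p * case_prod B p)\<^sup>2
      \<le> (\<Sum>p\<in>{..<N} \<times> {..<N}. (A $$ p)\<^sup>2) * (\<Sum>p\<in>{..<N} \<times> {..<N}. (case_prod B p)\<^sup>2)"
    by (rule Cauchy_Schwarz_ineq_sum)
  also have "(\<Sum>p\<in>{..<N} \<times> {..<N}. A $$ p * case_prod B p) = real N * k * S"
    unfolding AB[symmetric] sum.cartesian_product by (intro sum.cong) auto
  also have "(\<Sum>p\<in>{..<N} \<times> {..<N}. (A $$ p)\<^sup>2) = F"
    unfolding F_def sum.cartesian_product by (intro sum.cong) auto
  also have "(\<Sum>p\<in>{..<N} \<times> {..<N}. (case_prod B p)\<^sup>2) = real N * (real N - 1) * S\<^sup>2"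
    unfolding BB[symmetric] sum.cartesian_product by (intro sum.cong) auto
  finally have "(real N * S\<^sup>2) * (real N * k\<^sup>2) \<le> (real N * S\<^sup>2) * ((real N - 1) * F)"
    by (simp add: power2_eq_square algebra_simps)
  then show ?thesis
    using N S unfolding F_def by (simp add: mult_le_cancel_left_pos)
qed

section \<open>Real eigenvalues of symmetric matrices\<close>

text \<open>
  For an eigenvector \<open>z\<close> the sum of \<open>A\<^sub>i\<^sub>j cnj(z\<^sub>i) z\<^sub>j\<close> is \<open>k \<bar>z\<bar>\<^sup>2\<close>, and it is invariant under
  conjugation because that merely swaps the two summation indices.
\<close>

lemma complex_eigenvalue_symmetric_real:
  fixes A :: "real mat"
  assumes A: "A \<in> carrier_mat N N"
    and sym: "\<And>i j. i < N \<Longrightarrow> j < N \<Longrightarrow> A $$ (i,j) = A $$ (j,i)"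
    and k: "eigenvalue (map_mat complex_of_real A) k"
  shows "k \<in> \<real>"
proof -
  have "map_mat complex_of_real A \<in> carrier_mat N N" using A by simp
  from eigenvalue_sumE[OF this k] obtain z
    where "\<And>i. i < N \<Longrightarrow> (\<Sum>j<N. map_mat complex_of_real A $$ (i,j) * z j) = k * z i"
      and nz: "\<exists>i<N. z i \<noteq> 0" by blast
  then have z: "\<And>i. i < N \<Longrightarrow> (\<Sum>j<N. of_real (A $$ (i,j)) * z j) = k * z i"
    using A by simp
  define S where "S = (\<Sum>i<N. (cmod (z i))\<^sup>2)"
  define Q where "Q = (\<Sum>i<N. \<Sum>j<N. of_real (A $$ (i,j)) * (cnj (z i) * z j))"
  have S: "S > 0" using nz unfolding S_def by (auto intro!: sum_pos2)
  have "Q = (\<Sum>i<N. cnj (z i) * (\<Sum>j<N. of_real (A $$ (i,j)) * z j))"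
    unfolding Q_def by (simp add: sum_distrib_left algebra_simps)
  also have "\<dots> = (\<Sum>i<N. cnj (z i) * (k * z i))"
    using z by simp
  also have "\<dots> = k * of_real S"
    unfolding S_def of_real_sum sum_distrib_left
    by (intro sum.cong) (simp_all only: complex_norm_square ac_simps)
  finally have Q: "Q = k * of_real S" .
  have "cnj Q = (\<Sum>i<N. \<Sum>j<N. of_real (A $$ (j,i)) * (cnj (z j) * z i))"
    unfolding Q_def using sym by (simp add: algebra_simps)
  also have "\<dots> = Q"
    unfolding Q_def by (rule sum.swap)
  finally have "Q \<in> \<real>" by (simp add: Reals_cnj_iff)
  moreover have "k = Q / of_real S" using Q S by simp
  ultimately show ?thesis by (simp add: Reals_divide)
qed

text \<open>
  The complexification of \<open>A\<close> has an eigenvalue, which is real by symmetry and is therefore a root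
  of the characteristic polynomial of \<open>A\<close> itself.
\<close>

lemma spectrum_symmetric_nonempty:
  fixes A :: "real mat"
  assumes A: "A \<in> carrier_mat N N" and N: "N > 0"
    and sym: "\<And>i j. i < N \<Longrightarrow> j < N \<Longrightarrow> A $$ (i,j) = A $$ (j,i)"
  shows "spectrum A \<noteq> {}"
proof -
  let ?C = "map_mat complex_of_real A"
  have C: "?C \<in> carrier_mat N N" using A by simp
  obtain k where k: "eigenvalue ?C k"
    using spectrum_non_empty[OF C] N unfolding spectrum_def by auto
  obtain r where r: "k = of_real r"
    using complex_eigenvalue_symmetric_real[OF A sym k] by (auto elim: Reals_cases)
  have "poly (char_poly ?C) (of_real r) = 0"
    using k r eigenvalue_root_char_poly[OF C] by simp
  then have "poly (char_poly A) r = 0"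
    by (simp add: of_real_hom.char_poly_hom[OF A])
  then show ?thesis
    using eigenvalue_root_char_poly[OF A] unfolding spectrum_def by auto
qed

section \<open>Counting the entries of the adjacency blocks\<close>

text \<open>
  Double counting: an edge that joins \<open>a\<close> and \<open>b\<close> is counted at \<open>(a, b)\<close> and at \<open>(b, a)\<close>,
  which are distinct pairs because there are no loops.
\<close>

lemma (in simple_mixed_graph) sum_edges_between:
  "(\<Sum>u\<in>verts G. \<Sum>w\<in>verts G. card (edges_between G u w)) = 2 * card (edges G)"
proof -
  have inner: "(\<Sum>u\<in>verts G. \<Sum>w\<in>verts G. of_bool (ends G e = Upair u w)) = (2::nat)"
    if e: "e \<in> edges G" for e
  proof -
    obtain a b where ab: "ends G e = Upair a b"
      by (cases "ends G e") auto
    have V: "a \<in> verts G" "b \<in> verts G"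
      using ends_in_verts[OF e] ab by auto
    have neq: "a \<noteq> b"
      using no_loops[OF V(1)] e ab by (auto simp: edges_between_def)
    have "(\<Sum>u\<in>verts G. \<Sum>w\<in>verts G. of_bool (ends G e = Upair u w))
        = (\<Sum>p\<in>verts G \<times> verts G. of_bool (p = (a,b) \<or> p = (b,a)) :: nat)"
      unfolding sum.cartesian_product by (intro sum.cong) (auto simp: ab)
    also have "\<dots> = card ((verts G \<times> verts G) \<inter> {p. p = (a,b) \<or> p = (b,a)})"
      using finite_verts by (simp only: sum_of_bool_eq finite_cartesian_product) simp
    also have "(verts G \<times> verts G) \<inter> {p. p = (a,b) \<or> p = (b,a)} = {(a,b), (b,a)}"
      using V by auto
    finally show ?thesis using neq by simp
  qed
  have "(\<Sum>u\<in>verts G. \<Sum>w\<in>verts G. card (edges_between G u w))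
      = (\<Sum>u\<in>verts G. \<Sum>w\<in>verts G. \<Sum>e\<in>edges G. of_bool (ends G e = Upair u w))"
    using finite_edges by (simp add: edges_between_def sum_of_bool_eq Int_def)
  also have "\<dots> = (\<Sum>u\<in>verts G. \<Sum>e\<in>edges G. \<Sum>w\<in>verts G. of_bool (ends G e = Upair u w))"
    by (intro sum.cong refl sum.swap)
  also have "\<dots> = (\<Sum>e\<in>edges G. \<Sum>u\<in>verts G. \<Sum>w\<in>verts G. of_bool (ends G e = Upair u w))"
    by (rule sum.swap)
  finally show ?thesis using inner by simp
qed

lemma (in mixed_graph) sum_arcs_from_to:
  "(\<Sum>u\<in>verts G. \<Sum>w\<in>verts G. card (arcs_from_to G u w)) = card (arcs G)"
proof -
  have "card (arcs G) = card (\<Union>p\<in>verts G \<times> verts G. arcs_from_to G (fst p) (snd p))"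
    by (rule arg_cong[of _ _ card])
      (auto simp: arcs_from_to_def tail_in_verts head_in_verts)
  also have "\<dots> = (\<Sum>p\<in>verts G \<times> verts G. card (arcs_from_to G (fst p) (snd p)))"
    using finite_verts finite_arcs
    by (intro card_UN_disjoint) (auto simp: arcs_from_to_def)
  finally show ?thesis
    by (simp add: sum.cartesian_product case_prod_beta)
qed

lemma edges_between_commute: "edges_between G u w = edges_between G w u"
  by (auto simp: edges_between_def)

lemma square_of_nat_le_1: "c \<le> 1 \<Longrightarrow> (real c)\<^sup>2 = real c"
  by (cases c) auto

section \<open>The integrated adjacency matrix\<close>

lemma sum_lessThan_double:
  fixes f :: "nat \<Rightarrow> 'a :: comm_monoid_add"
  shows "(\<Sum>i<n + n. f i) = (\<Sum>i<n. f i) + (\<Sum>i<n. f (i + n))"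
proof -
  have "(\<Sum>i<n + n. f i) = (\<Sum>i=0..<n. f i) + (\<Sum>i=n..<n + n. f i)"
    by (simp add: sum.atLeastLessThan_concat lessThan_atLeast0)
  also have "(\<Sum>i=n..<n + n. f i) = (\<Sum>i=0..<n. f (i + n))"
    using sum.shift_bounds_nat_ivl[of f 0 n n] by simp
  finally show ?thesis by (simp add: lessThan_atLeast0)
qed

lemma sum_square_four_block_mat:
  fixes A B C D :: "real mat"
  assumes "A \<in> carrier_mat n n" "B \<in> carrier_mat n n" "C \<in> carrier_mat n n" "D \<in> carrier_mat n n"
  shows "(\<Sum>i<n + n. \<Sum>j<n + n. (four_block_mat A B C D $$ (i,j))\<^sup>2)
    = (\<Sum>i<n. \<Sum>j<n. (A $$ (i,j))\<^sup>2) + (\<Sum>i<n. \<Sum>j<n. (B $$ (i,j))\<^sup>2)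
      + (\<Sum>i<n. \<Sum>j<n. (C $$ (i,j))\<^sup>2) + (\<Sum>i<n. \<Sum>j<n. (D $$ (i,j))\<^sup>2)"
  using assms by (simp add: sum_lessThan_double sum.distrib)

context simple_mixed_graph
begin

context
  fixes v :: "nat \<Rightarrow> 'a" and n :: nat
  assumes n: "n = card (verts G)" and v: "bij_betw v {..<n} (verts G)"
begin

lemma enumeration_in_verts: "i < n \<Longrightarrow> v i \<in> verts G"
  using bij_betw_apply[OF v] by simp

lemma sum_enumeration:
  "(\<Sum>i<n. \<Sum>j<n. f (v i) (v j)) = (\<Sum>u\<in>verts G. \<Sum>w\<in>verts G. f u w)"
  using sum.reindex_bij_betw[OF v, of "\<lambda>u. \<Sum>w\<in>verts G. f u w"]
  by (simp add: sum.reindex_bij_betw[OF v])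

lemma edge_adj_mat_carrier: "edge_adj_mat G v \<in> carrier_mat n n"
  by (simp add: edge_adj_mat_def n)

lemma arc_adj_mat_carrier: "arc_adj_mat G v \<in> carrier_mat n n"
  by (simp add: arc_adj_mat_def n)

lemma edge_adj_mat_entry:
  "i < n \<Longrightarrow> j < n \<Longrightarrow> edge_adj_mat G v $$ (i,j) = real (card (edges_between G (v i) (v j)))"
  using no_loops[OF enumeration_in_verts[of i]] by (auto simp: edge_adj_mat_def n)

lemma arc_adj_mat_entry:
  "i < n \<Longrightarrow> j < n \<Longrightarrow> arc_adj_mat G v $$ (i,j) = real (card (arcs_from_to G (v i) (v j)))"
  by (simp add: arc_adj_mat_def n)

lemma integrated_adj_mat_carrier: "integrated_adj_mat G v \<in> carrier_mat (n + n) (n + n)"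
  unfolding integrated_adj_mat_def
  using edge_adj_mat_carrier by (intro four_block_carrier_mat) auto

lemma integrated_adj_mat_symmetric:
  "i < n + n \<Longrightarrow> j < n + n \<Longrightarrow>
    integrated_adj_mat G v $$ (i,j) = integrated_adj_mat G v $$ (j,i)"
  using edge_adj_mat_carrier arc_adj_mat_carrier
  by (auto simp: integrated_adj_mat_def edge_adj_mat_entry edges_between_commute)

lemma integrated_adj_mat_diagonal:
  "i < n + n \<Longrightarrow> integrated_adj_mat G v $$ (i,i) = 0"
  using edge_adj_mat_carrier arc_adj_mat_carrier
  by (auto simp: integrated_adj_mat_def edge_adj_mat_entry no_loops enumeration_in_verts)

lemma sum_square_edge_adj_mat:
  "(\<Sum>i<n. \<Sum>j<n. (edge_adj_mat G v $$ (i,j))\<^sup>2) = 2 * real (card (edges G))"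
proof -
  have "(\<Sum>i<n. \<Sum>j<n. (edge_adj_mat G v $$ (i,j))\<^sup>2)
      = real (\<Sum>i<n. \<Sum>j<n. card (edges_between G (v i) (v j)))"
    by (simp add: edge_adj_mat_entry
        square_of_nat_le_1[OF no_multi_edges[OF enumeration_in_verts enumeration_in_verts]])
  then show ?thesis
    by (simp only: sum_enumeration[of "\<lambda>u w. card (edges_between G u w)"] sum_edges_between of_nat_mult of_nat_numeral)
qed

lemma sum_square_arc_adj_mat:
  "(\<Sum>i<n. \<Sum>j<n. (arc_adj_mat G v $$ (i,j))\<^sup>2) = real (card (arcs G))"
proof -
  have "(\<Sum>i<n. \<Sum>j<n. (arc_adj_mat G v $$ (i,j))\<^sup>2)
      = real (\<Sum>i<n. \<Sum>j<n. card (arcs_from_to G (v i) (v j)))"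
    by (simp add: arc_adj_mat_entry
        square_of_nat_le_1[OF no_multi_arcs[OF enumeration_in_verts enumeration_in_verts]])
  then show ?thesis
    by (simp only: sum_enumeration[of "\<lambda>u w. card (arcs_from_to G u w)"] sum_arcs_from_to)
qed

lemma sum_square_integrated_adj_mat:
  "(\<Sum>i<n + n. \<Sum>j<n + n. (integrated_adj_mat G v $$ (i,j))\<^sup>2)
    = 2 * (2 * real (card (edges G)) + real (card (arcs G)))"
proof -
  have "(\<Sum>i<n. \<Sum>j<n. (transpose_mat (arc_adj_mat G v) $$ (i,j))\<^sup>2)
      = (\<Sum>i<n. \<Sum>j<n. (arc_adj_mat G v $$ (j,i))\<^sup>2)"
    using arc_adj_mat_carrier by simp
  also have "\<dots> = real (card (arcs G))"
    by (subst sum.swap) (rule sum_square_arc_adj_mat)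
  finally show ?thesis
    unfolding integrated_adj_mat_def
    using edge_adj_mat_carrier arc_adj_mat_carrier
    by (subst sum_square_four_block_mat)
      (simp_all add: sum_square_edge_adj_mat sum_square_arc_adj_mat)
qed

lemma largest_eigenvalue_integrated_adj_mat_is_eigenvalue:
  "eigenvalue (integrated_adj_mat G v) (largest_eigenvalue (integrated_adj_mat G v))"
proof -
  have "n > 0" using n finite_verts verts_nonempty by (simp add: card_gt_0_iff)
  then have "spectrum (integrated_adj_mat G v) \<noteq> {}"
    using integrated_adj_mat_symmetric
    by (intro spectrum_symmetric_nonempty[OF integrated_adj_mat_carrier]) auto
  moreover have "finite (spectrum (integrated_adj_mat G v))"
    using card_finite_spectrum(1)[OF integrated_adj_mat_carrier] .
  ultimately have "Max (spectrum (integrated_adj_mat G v)) \<in> spectrum (integrated_adj_mat G v)"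
    by (intro Max_in)
  then show ?thesis by (simp add: largest_eigenvalue_def spectrum_def)
qed

end

end

theorem theorem8p5:
  fixes G :: "('v, 'e, 'a) mixed_graph" and v :: "nat \<Rightarrow> 'v" and n :: nat
  assumes "simple_mixed_graph G"
    and "n = card (verts G)"
    and "bij_betw v {..<n} (verts G)"
  shows "largest_eigenvalue (integrated_adj_mat G v)
    \<le> sqrt ((2 * real n - 1) * (2 * real (card (edges G)) + real (card (arcs G))) / real n)"
proof -
  interpret simple_mixed_graph G by fact
  note enum = assms(2,3)
  let ?M = "integrated_adj_mat G v"
  let ?k = "largest_eigenvalue ?M"
  let ?m = "2 * real (card (edges G)) + real (card (arcs G))"
  have n: "real n > 0"
    using assms(2) finite_verts verts_nonempty by (simp add: card_gt_0_iff)
  have "real (n + n) * ?k\<^sup>2 \<le> (real (n + n) - 1) * (2 * ?m)"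
    using eigenvalue_sq_le_of_trace_zero[OF integrated_adj_mat_carrier[OF enum]
        largest_eigenvalue_integrated_adj_mat_is_eigenvalue[OF enum]]
    by (simp only: sum_square_integrated_adj_mat[OF enum])
      (simp add: integrated_adj_mat_diagonal[OF enum])
  then have "?k\<^sup>2 * real n \<le> (2 * real n - 1) * ?m"
    by (simp add: algebra_simps)
  then have "?k\<^sup>2 \<le> (2 * real n - 1) * ?m / real n"
    using n by (simp only: pos_le_divide_eq)
  then show ?thesis
    by (rule real_le_rsqrt)
qed

end
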